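(* Let $f:\mathbb{S}^2\to\mathbb{R}^3$ be a smooth embedding with unit normal field $n=n_f$ and principal curvatures $\kappa_1,\kappa_2$, and let $h,k\in\mathcal{C}^\infty(\mathbb{S}^2,\mathbb{R})$. Then the elastic metric $\langle\!\langle\cdot,\cdot\rangle\!\rangle$ with weights $a,b,c$, evaluated at $f$ on the normal vector fields $hn$ and $kn$, is $$\langle\!\langle hn,kn\rangle\!\rangle_f=\int_{\mathbb{S}^2}ds\,|g|^{1/2}\left\{hk\left(2a(\kappa_1-\kappa_2)^2+4b(\kappa_1+\kappa_2)^2\right)+c\begin{pmatrix}h_u&h_v\end{pmatrix}g^{-1}\begin{pmatrix}k_u\\k_v\end{pmatrix}\right\}.$$
   Context: In local coordinates $(u,v)$ on $\mathbb{S}^2$ (compatible with its orientation), subscripts denote partial derivatives; $g=\mathrm{Jac}(f)^T\mathrm{Jac}(f)$, with $\mathrm{Jac}(f)=[f_u\ f_v]$, is the first fundamental form; $|g|^{1/2}=\sqrt{\det g}$; and $n_f=\frac{f_u\times f_v}{\|f_u\times f_v\|}$. The second fundamental form $\mathbf{II}$ has matrix entries $-f_u\cdot n_u$, $-f_u\cdot n_v=-f_v\cdot n_u$, $-f_v\cdot n_v$; the shape operator is $\mathbf{L}=g^{-1}\mathbf{II}$, and $\kappa_1,\kappa_2$ are its eigenvalues. For $\delta f_1,\delta f_2\in\mathcal{C}^\infty(\mathbb{S}^2,\mathbb{R}^3)$ let $(\delta g_i,\delta n_i)$ be the derivative at $f$ in the direction $\delta f_i$ of the map $f\mapsto(g,n_f)$.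 The elastic metric with real constant weights $a,b,c$ is $$\langle\!\langle\delta f_1,\delta f_2\rangle\!\rangle_f=\int_{\mathbb{S}^2}ds\,|g|^{1/2}\left\{a\,\mathrm{Tr}\big((g^{-1}\delta g_1)_{\mathbf 0}(g^{-1}\delta g_2)_{\mathbf 0}\big)+b\,\mathrm{Tr}(g^{-1}\delta g_1)\mathrm{Tr}(g^{-1}\delta g_2)+c\,\delta n_1\cdot\delta n_2\right\},$$ where $A_{\mathbf 0}=A-\frac{\mathrm{Tr}(A)}{2}I_{2\times2}$ is the traceless part of a $2\times2$ matrix $A$, and $ds\,|g|^{1/2}$ (with $ds=du\,dv$ in coordinates) denotes the area measure of the Riemannian metric $g$ on $\mathbb{S}^2$. *)

theory Defs
  imports "HOL-Analysis.Analysis"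
begin

abbreviation S2 :: "(real^3) set" where
  "S2 \<equiv> sphere 0 1"

primrec Ck_on :: "nat \<Rightarrow> 'a::euclidean_space set \<Rightarrow> ('a \<Rightarrow> 'b::real_normed_vector) \<Rightarrow> bool" where
  "Ck_on 0 U F \<longleftrightarrow> continuous_on U F"
| "Ck_on (Suc m) U F \<longleftrightarrow>
     (\<forall>x\<in>U. F differentiable (at x)) \<and>
     (\<forall>i\<in>Basis. Ck_on m U (\<lambda>x. frechet_derivative F (at x) i))"

definition smooth_on :: "'a::euclidean_space set \<Rightarrow> ('a \<Rightarrow> 'b::real_normed_vector) \<Rightarrow> bool" where
  "smooth_on U F \<longleftrightarrow> (\<forall>m. Ck_on m U F)"

(* For F a function of local coordinates (u,v), pderiv2 1 F = F_u and pderiv2 2 F = F_v. *)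
definition pderiv2 :: "2 \<Rightarrow> (real^2 \<Rightarrow> 'b::real_normed_vector) \<Rightarrow> real^2 \<Rightarrow> 'b" where
  "pderiv2 i F s = vector_derivative (\<lambda>t. F (s + t *\<^sub>R axis i 1)) (at 0)"

(* Local coordinates are given by their inverse, a parametrization x of an open subset of the
   sphere by an open U in the plane. The sphere carries its outward orientation, so positivity
   of the triple product says both that x is an immersion and that it preserves orientation. *)
definition oriented_coords :: "(real^2) set \<Rightarrow> (real^2 \<Rightarrow> real^3) \<Rightarrow> bool" where
  "oriented_coords U x \<longleftrightarrow>
     open U \<and> smooth_on U x \<and>
     x ` U \<subseteq> S2 \<and> openin (top_of_set S2) (x ` U) \<and>
     (\<exists>y. homeomorphism U (x ` U) x y) \<and>
     (\<forall>s\<in>U. cross3 (pderiv2 1 x s) (pderiv2 2 x s) \<bullet> x s > 0)"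

(* Maps on the sphere are total functions on the ambient space;
   only their values on S2 are ever used. *)
definition smooth_on_S2 :: "(real^3 \<Rightarrow> 'b::real_normed_vector) \<Rightarrow> bool" where
  "smooth_on_S2 F \<longleftrightarrow> (\<forall>U x. oriented_coords U x \<longrightarrow> smooth_on U (F \<circ> x))"

definition smooth_embedding :: "(real^3 \<Rightarrow> real^3) \<Rightarrow> bool" where
  "smooth_embedding f \<longleftrightarrow>
     smooth_on_S2 f \<and>
     (\<forall>U x. oriented_coords U x \<longrightarrow> (\<forall>s\<in>U. inj (frechet_derivative (f \<circ> x) (at s)))) \<and>
     (\<exists>y. homeomorphism S2 (f ` S2) f y)"

text \<open>Geometric quantities of a surface in local coordinates: here \<open>F\<close> stands for \<open>f \<circ> x\<close>,
  with \<open>x\<close> a parametrization of part of the sphere, and \<open>s\<close> is a point of the coordinate domain.\<close>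

definition Jac :: "(real^2 \<Rightarrow> real^3) \<Rightarrow> real^2 \<Rightarrow> real^2^3" where
  "Jac F s = (\<chi> i j. pderiv2 j F s $ i)"

definition first_form :: "(real^2 \<Rightarrow> real^3) \<Rightarrow> real^2 \<Rightarrow> real^2^2" where
  "first_form F s = transpose (Jac F s) ** Jac F s"

definition normal :: "(real^2 \<Rightarrow> real^3) \<Rightarrow> real^2 \<Rightarrow> real^3" where
  "normal F s =
     cross3 (pderiv2 1 F s) (pderiv2 2 F s) /\<^sub>R norm (cross3 (pderiv2 1 F s) (pderiv2 2 F s))"

definition second_form :: "(real^2 \<Rightarrow> real^3) \<Rightarrow> real^2 \<Rightarrow> real^2^2" where
  "second_form F s = (\<chi> i j. - (pderiv2 i F s \<bullet> pderiv2 j (normal F) s))"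

definition shape_operator :: "(real^2 \<Rightarrow> real^3) \<Rightarrow> real^2 \<Rightarrow> real^2^2" where
  "shape_operator F s = matrix_inv (first_form F s) ** second_form F s"

(* l1 and l2 are the eigenvalues of A, listed with algebraic multiplicity. *)
definition eigenvalues2 :: "real^2^2 \<Rightarrow> real \<Rightarrow> real \<Rightarrow> bool" where
  "eigenvalues2 A l1 l2 \<longleftrightarrow> (\<forall>t. det (mat t - A) = (t - l1) * (t - l2))"

definition grad2 :: "(real^2 \<Rightarrow> real) \<Rightarrow> real^2 \<Rightarrow> real^2" where
  "grad2 h s = (\<chi> i. pderiv2 i h s)"

definition var_first_form ::
  "(real^2 \<Rightarrow> real^3) \<Rightarrow> (real^2 \<Rightarrow> real^3) \<Rightarrow> real^2 \<Rightarrow> real^2^2" where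
  "var_first_form F D s = vector_derivative (\<lambda>t. first_form (\<lambda>r. F r + t *\<^sub>R D r) s) (at 0)"

definition var_normal ::
  "(real^2 \<Rightarrow> real^3) \<Rightarrow> (real^2 \<Rightarrow> real^3) \<Rightarrow> real^2 \<Rightarrow> real^3" where
  "var_normal F D s = vector_derivative (\<lambda>t. normal (\<lambda>r. F r + t *\<^sub>R D r) s) (at 0)"

definition traceless :: "real^2^2 \<Rightarrow> real^2^2" where
  "traceless A = A - (trace A / 2) *\<^sub>R mat 1"

definition elastic_integrand ::
  "real \<Rightarrow> real \<Rightarrow> real \<Rightarrow> (real^2 \<Rightarrow> real^3) \<Rightarrow> (real^2 \<Rightarrow> real^3) \<Rightarrow> (real^2 \<Rightarrow> real^3) \<Rightarrow> real^2 \<Rightarrow> real"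
where
  "elastic_integrand a b c F D1 D2 s =
     (let G1 = matrix_inv (first_form F s) ** var_first_form F D1 s;
          G2 = matrix_inv (first_form F s) ** var_first_form F D2 s
      in a * trace (traceless G1 ** traceless G2) + b * (trace G1 * trace G2)
         + c * (var_normal F D1 s \<bullet> var_normal F D2 s))"

(* The Borel measure on the sphere that is |g|^(1/2) du dv in all local coordinates; it is unique
   because countably many coordinate domains cover the sphere, and it exists, for an immersion f,
   because sqrt (det g) du dv is invariant under changes of coordinates. *)
definition area_measure :: "(real^3 \<Rightarrow> real^3) \<Rightarrow> (real^3) measure" where
  "area_measure f = (THE M.
     sets M = sets (restrict_space borel S2) \<and>
     (\<forall>U x B. oriented_coords U x \<longrightarrow> B \<in> sets borel \<longrightarrow> B \<subseteq> U \<longrightarrow>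
        emeasure M (x ` B) = (\<integral>\<^sup>+ s\<in>B. ennreal (sqrt (det (first_form (f \<circ> x) s))) \<partial>lborel)))"

text \<open>A choice of oriented local coordinates \<open>C p = (U, x)\<close> around each point \<open>p\<close> of the sphere, used
  to evaluate pointwise quantities at \<open>p\<close>. The charts at different points are unrelated, and the
  unit normal field and the elastic metric below do not depend on the choice.\<close>

type_synonym coord_choice = "real^3 \<Rightarrow> (real^2) set \<times> (real^2 \<Rightarrow> real^3)"

definition coords_at_points :: "coord_choice \<Rightarrow> bool" where
  "coords_at_points C \<longleftrightarrow>
     (\<forall>p\<in>S2. oriented_coords (fst (C p)) (snd (C p)) \<and> p \<in> snd (C p) ` fst (C p))"

definition coord_of :: "coord_choice \<Rightarrow> real^3 \<Rightarrow> real^2" where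
  "coord_of C p = inv_into (fst (C p)) (snd (C p)) p"

definition in_coords :: "coord_choice \<Rightarrow> real^3 \<Rightarrow> (real^3 \<Rightarrow> 'b) \<Rightarrow> real^2 \<Rightarrow> 'b" where
  "in_coords C p F = F \<circ> snd (C p)"

definition unit_normal :: "coord_choice \<Rightarrow> (real^3 \<Rightarrow> real^3) \<Rightarrow> real^3 \<Rightarrow> real^3" where
  "unit_normal C f p = normal (in_coords C p f) (coord_of C p)"

definition principal_curvatures ::
  "coord_choice \<Rightarrow> (real^3 \<Rightarrow> real^3) \<Rightarrow> (real^3 \<Rightarrow> real) \<Rightarrow> (real^3 \<Rightarrow> real) \<Rightarrow> bool" where
  "principal_curvatures C f \<kappa>1 \<kappa>2 \<longleftrightarrow>
     (\<forall>p\<in>S2. eigenvalues2 (shape_operator (in_coords C p f) (coord_of C p)) (\<kappa>1 p) (\<kappa>2 p))"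

definition elastic_metric ::
  "coord_choice \<Rightarrow> real \<Rightarrow> real \<Rightarrow> real \<Rightarrow>
   (real^3 \<Rightarrow> real^3) \<Rightarrow> (real^3 \<Rightarrow> real^3) \<Rightarrow> (real^3 \<Rightarrow> real^3) \<Rightarrow> real" where
  "elastic_metric C a b c f d1 d2 =
     (LINT p:S2|area_measure f.
        elastic_integrand a b c (in_coords C p f) (in_coords C p d1) (in_coords C p d2)
          (coord_of C p))"

end

(* The two integrands agree at every point p, so nothing has to be known about the area measure.
   In the chart at p put F = f o x and n = normal F. The variation of g along h n is -2 h II, hence
   g^-1 delta g = -2 h L, and the traces of products of multiples of L are symmetric polynomials in
   the principal curvatures. The variation of n along h n is the tangential part of
   (f_u x (h n)_v + (h n)_u x f_v) / |f_u x f_v|; there the terms h (f_u x n_v + n_u x f_v) are normal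
   and drop out, and the Gram matrix of the remaining n x f_v and f_u x n is the adjugate of g.

   Two analytic facts are needed: symmetry of second derivatives, which makes II symmetric, and
   independence of the unit normal from the oriented chart. The latter is used because the vector
   field h n near p is given by unrelated charts at the points near p. *)

theory Submission
  imports Defs
begin

section \<open>Symmetry of second derivatives\<close>

text \<open>By the mean value theorem in direction \<open>u\<close>, the second difference is \<open>t\<close> times an increment
  of \<open>f' x u\<close> along \<open>t v\<close>. As the quotient is symmetric in \<open>u\<close> and \<open>v\<close>, this proves Young's form of
  the symmetry of second derivatives, without continuity of the latter.\<close>

lemma second_difference_quotient:
  fixes f :: "'a::real_normed_vector \<Rightarrow> real"
  assumes U: "open U" "s \<in> U"
    and f': "\<And>x. x \<in> U \<Longrightarrow> (f has_derivative f' x) (at x)"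
    and A: "((\<lambda>x. f' x u) has_derivative A) (at s)"
  shows "((\<lambda>t. (f (s + t *\<^sub>R u + t *\<^sub>R v) - f (s + t *\<^sub>R u) - f (s + t *\<^sub>R v) + f s) / t\<^sup>2) \<longlongrightarrow> A v) (at_right 0)"
proof (rule tendstoI)
  fix e :: real assume e: "e > 0"
  \<comment> \<open>\<open>K\<close> strictly exceeds \<open>norm u + norm v\<close>: the
    parallelogram spanned by \<open>t *\<^sub>R u\<close> and \<open>t *\<^sub>R v\<close> lies
    within \<open>t * K\<close> of \<open>s\<close>, and the strictness makes the final estimate
    less than \<open>e\<close>.\<close>
  define K where "K = 2 * norm u + norm v + 1"
  have K: "K > 0" by (simp add: K_def add_nonneg_pos)
  obtain r where r: "r > 0" "ball s r \<subseteq> U" using U openE by blast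
  \<comment> \<open>The linear approximation by \<open>A\<close> is used at two points, hence the
    factor 2.\<close>
  have "e / (2 * K) > 0" using e K by simp
  then obtain d where d: "d > 0"
    "\<And>y. norm (y - s) < d \<Longrightarrow> norm (f' y u - f' s u - A (y - s)) \<le> e / (2 * K) * norm (y - s)"
    using A[unfolded has_derivative_at_alt, THEN conjunct2, rule_format, of "e / (2 * K)"] by auto
  interpret A: bounded_linear A using A by (rule has_derivative_bounded_linear)
  define q where "q = min r d / K"
  have q: "q > 0" using r d K by (simp add: q_def)
  have "dist ((f (s + t *\<^sub>R u + t *\<^sub>R v) - f (s + t *\<^sub>R u) - f (s + t *\<^sub>R v) + f s) / t\<^sup>2) (A v) < e"
    if t: "0 < t" "t < q" for t
  proof -
    have tK: "t * K < r" "t * K < d"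
      using t K by (auto simp: q_def pos_less_divide_eq)
    have near: "norm (x *\<^sub>R u + y *\<^sub>R v) \<le> t * (norm u + norm v)" "norm (x *\<^sub>R u + y *\<^sub>R v) < r"
        "norm (x *\<^sub>R u + y *\<^sub>R v) < d"
      if "0 \<le> x" "x \<le> t" "0 \<le> y" "y \<le> t" for x y
    proof -
      have "norm (x *\<^sub>R u + y *\<^sub>R v) \<le> x * norm u + y * norm v"
        using norm_triangle_ineq[of "x *\<^sub>R u" "y *\<^sub>R v"] that by simp
      also have "\<dots> \<le> t * (norm u + norm v)"
        using that by (auto simp: algebra_simps intro!: add_mono mult_right_mono)
      finally show 1: "norm (x *\<^sub>R u + y *\<^sub>R v) \<le> t * (norm u + norm v)" .
      have "t * (norm u + norm v) \<le> t * K" using t by (intro mult_left_mono) (auto simp: K_def)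
      with 1 tK show "norm (x *\<^sub>R u + y *\<^sub>R v) < r" "norm (x *\<^sub>R u + y *\<^sub>R v) < d" by auto
    qed
    have inU: "s + x *\<^sub>R u + y *\<^sub>R v \<in> U" if "0 \<le> x" "x \<le> t" "0 \<le> y" "y \<le> t" for x y
    proof -
      have "dist s (s + (x *\<^sub>R u + y *\<^sub>R v)) < r" using near(2)[OF that] by (metis dist_add_cancel dist_0_norm add.right_neutral)
      then show ?thesis using r(2) by (auto simp: algebra_simps)
    qed
    \<comment> \<open>The second difference is \<open>\<phi> t - \<phi> 0\<close>. The summand
      \<open>0 *\<^sub>R v\<close> lets \<open>D\<close> apply to both terms, with
      \<open>y = t\<close> and \<open>y = 0\<close>.\<close>
    define \<phi> where "\<phi> x = f (s + x *\<^sub>R u + t *\<^sub>R v) - f (s + x *\<^sub>R u + 0 *\<^sub>R v)" for x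
    have D: "((\<lambda>x. f (s + x *\<^sub>R u + y *\<^sub>R v)) has_real_derivative f' (s + x *\<^sub>R u + y *\<^sub>R v) u) (at x)"
      if "0 \<le> x" "x \<le> t" "0 \<le> y" "y \<le> t" for x y
    proof -
      have d1: "((\<lambda>x. s + x *\<^sub>R u + y *\<^sub>R v) has_derivative (\<lambda>h. h *\<^sub>R u)) (at x)"
        by (auto intro!: derivative_eq_intros)
      have "((\<lambda>x. f (s + x *\<^sub>R u + y *\<^sub>R v)) has_derivative (\<lambda>h. f' (s + x *\<^sub>R u + y *\<^sub>R v) (h *\<^sub>R u))) (at x)"
        by (rule has_derivative_compose[OF d1 f'[OF inU[OF that]]])
      moreover have "f' (s + x *\<^sub>R u + y *\<^sub>R v) (h *\<^sub>R u) = f' (s + x *\<^sub>R u + y *\<^sub>R v) u * h" for h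
        using linear_cmul[OF has_derivative_linear[OF f'[OF inU[OF that]]]] by simp
      ultimately show ?thesis by (simp add: has_field_derivative_def mult_commute_abs)
    qed
    have "\<exists>z. 0 < z \<and> z < t \<and> \<phi> t - \<phi> 0 = (t - 0) * (f' (s + z *\<^sub>R u + t *\<^sub>R v) u - f' (s + z *\<^sub>R u + 0 *\<^sub>R v) u)"
      unfolding \<phi>_def using t by (intro MVT2 DERIV_diff D) auto
    then obtain z where z: "0 < z" "z < t"
      "\<phi> t - \<phi> 0 = t * (f' (s + z *\<^sub>R u + t *\<^sub>R v) u - f' (s + z *\<^sub>R u + 0 *\<^sub>R v) u)" by auto
    have b: "norm (f' (s + z *\<^sub>R u + y *\<^sub>R v) u - f' s u - A (z *\<^sub>R u + y *\<^sub>R v)) \<le> e / (2 * K) * (t * (norm u + norm v))"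
      if "0 \<le> y" "y \<le> t" for y
    proof -
      have n: "norm ((s + z *\<^sub>R u + y *\<^sub>R v) - s) \<le> t * (norm u + norm v)" "norm ((s + z *\<^sub>R u + y *\<^sub>R v) - s) < d"
        using near[of z y] z that by (auto simp: algebra_simps)
      have "norm (f' (s + z *\<^sub>R u + y *\<^sub>R v) u - f' s u - A ((s + z *\<^sub>R u + y *\<^sub>R v) - s)) \<le> e / (2 * K) * norm ((s + z *\<^sub>R u + y *\<^sub>R v) - s)"
        by (rule d(2)[OF n(2)])
      also have "\<dots> \<le> e / (2 * K) * (t * (norm u + norm v))"
        using n(1) e K by (intro mult_left_mono) auto
      finally show ?thesis by (simp add: algebra_simps)
    qed
    define X where "X y = f' (s + z *\<^sub>R u + y *\<^sub>R v) u" for y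
    \<comment> \<open>The two linear parts differ by \<open>t * A v\<close>, so the unknown
      intermediate point \<open>z\<close> cancels.\<close>
    have "\<bar>X t - X 0 - t * A v\<bar> \<le> \<bar>X t - f' s u - A (z *\<^sub>R u + t *\<^sub>R v)\<bar> + \<bar>X 0 - f' s u - A (z *\<^sub>R u + 0 *\<^sub>R v)\<bar>"
      by (simp add: A.add A.scaleR)
    also have "\<dots> \<le> 2 * (e / (2 * K) * (t * (norm u + norm v)))"
      using add_mono[OF b[of t] b[of 0]] t unfolding X_def real_norm_def by linarith
    also have "\<dots> = e * t * ((norm u + norm v) / K)" by simp
    also have "\<dots> < e * t * 1"
      using e t K by (intro mult_strict_left_mono) (auto simp: K_def intro: add_strict_increasing2)
    finally have "t * \<bar>X t - X 0 - t * A v\<bar> < t * (e * t)"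
      using t by simp
    moreover have "t * \<bar>X t - X 0 - t * A v\<bar> = \<bar>\<phi> t - \<phi> 0 - t\<^sup>2 * A v\<bar>"
    proof -
      have "\<phi> t - \<phi> 0 - t\<^sup>2 * A v = t * (X t - X 0 - t * A v)"
        unfolding z(3) X_def by (simp add: power2_eq_square algebra_simps)
      then show ?thesis using t by (simp add: abs_mult)
    qed
    ultimately have "\<bar>\<phi> t - \<phi> 0 - t\<^sup>2 * A v\<bar> / t\<^sup>2 < e"
      using t by (simp add: pos_divide_less_eq power2_eq_square mult.assoc mult.left_commute)
    moreover have "\<bar>\<phi> t - \<phi> 0 - t\<^sup>2 * A v\<bar> / t\<^sup>2 = \<bar>(\<phi> t - \<phi> 0) / t\<^sup>2 - A v\<bar>"
    proof -
      have "(\<phi> t - \<phi> 0) / t\<^sup>2 - A v = (\<phi> t - \<phi> 0 - t\<^sup>2 * A v) / t\<^sup>2"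
        using t by (simp add: diff_divide_distrib)
      then show ?thesis using t by (simp add: abs_divide)
    qed
    ultimately show ?thesis
      by (simp add: \<phi>_def dist_real_def algebra_simps)
  qed
  then show "\<forall>\<^sub>F t in at_right 0. dist ((f (s + t *\<^sub>R u + t *\<^sub>R v) - f (s + t *\<^sub>R u) - f (s + t *\<^sub>R v) + f s) / t\<^sup>2) (A v) < e"
    using q by (auto simp: eventually_at_right_field)
qed

lemma second_derivative_symmetric_real:
  fixes f :: "'a::real_normed_vector \<Rightarrow> real"
  assumes U: "open U" "s \<in> U"
    and f': "\<And>x. x \<in> U \<Longrightarrow> (f has_derivative f' x) (at x)"
    and A: "((\<lambda>x. f' x u) has_derivative A) (at s)"
    and B: "((\<lambda>x. f' x v) has_derivative B) (at s)"
  shows "A v = B u"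
proof (rule tendsto_unique)
  show "((\<lambda>t. (f (s + t *\<^sub>R u + t *\<^sub>R v) - f (s + t *\<^sub>R u) - f (s + t *\<^sub>R v) + f s) / t\<^sup>2) \<longlongrightarrow> A v) (at_right 0)"
    by (rule second_difference_quotient[OF U f' A])
  show "((\<lambda>t. (f (s + t *\<^sub>R u + t *\<^sub>R v) - f (s + t *\<^sub>R u) - f (s + t *\<^sub>R v) + f s) / t\<^sup>2) \<longlongrightarrow> B u) (at_right 0)"
    using second_difference_quotient[OF U f' B, of u]
    by (simp add: algebra_simps)
qed simp

section \<open>Differentiability of transition maps\<close>

text \<open>Applied to a transition map \<open>g\<close> between charts \<open>f\<close> and \<open>h\<close>: these map into \<open>\<real>\<^sup>3\<close>, so the inverse
  function theorem does not apply directly.\<close>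

lemma has_derivative_factor:
  fixes f :: "'b::real_normed_vector \<Rightarrow> 'c::real_normed_vector" and g :: "'a::real_normed_vector \<Rightarrow> 'b"
  assumes f: "(f has_derivative f') (at (g y))"
    and P: "bounded_linear P" "P \<circ> f' = id"
    and g: "isCont g y"
    and h: "(h has_derivative h') (at y)"
    and fg: "\<forall>\<^sub>F z in nhds y. f (g z) = h z"
  shows "(g has_derivative P \<circ> h') (at y)"
proof -
  interpret P: bounded_linear P by fact
  interpret h: bounded_linear h' using h by (rule has_derivative_bounded_linear)
  obtain B where B: "B > 0" "\<And>x. norm (P x) \<le> norm x * B"
    using P.pos_bounded by blast
  obtain D where D: "D > 0" "\<And>x. norm (h' x) \<le> norm x * D"
    using h.pos_bounded by blast
  have Pf: "P (f' w) = w" for w using P(2) by (metis comp_apply id_apply)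
  have fgy: "f (g y) = h y" using fg by (rule eventually_nhds_x_imp_x)
  \<comment> \<open>This error is relative to the increment of \<open>g\<close>; the Lipschitz bound
    \<open>lip\<close> makes it relative to \<open>z - y\<close>.\<close>
  have f_small: "\<forall>\<^sub>F z in nhds y. norm (h z - h y - f' (g z - g y)) \<le> e * norm (g z - g y)" if "e > 0" for e
  proof -
    obtain d where d: "d > 0" "\<And>w. norm (w - g y) < d \<Longrightarrow> norm (f w - f (g y) - f' (w - g y)) \<le> e * norm (w - g y)"
      using f[unfolded has_derivative_at_alt, THEN conjunct2, rule_format, OF \<open>e > 0\<close>] by auto
    have "(g \<longlongrightarrow> g y) (nhds y)" using g by (simp add: isCont_def tendsto_at_iff_tendsto_nhds)
    then have "\<forall>\<^sub>F z in nhds y. dist (g z) (g y) < d" using d(1) by (rule tendstoD)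
    with fg show ?thesis
    proof eventually_elim
      case (elim z)
      then show ?case using d(2)[of "g z"] fgy by (simp add: dist_norm)
    qed
  qed
  have h_small: "\<forall>\<^sub>F z in nhds y. norm (h z - h y - h' (z - y)) \<le> e * norm (z - y)" if "e > 0" for e
    using h[unfolded has_derivative_at_alt, THEN conjunct2, rule_format, OF that]
    by (auto simp: eventually_nhds_metric dist_norm)
  have lip: "\<forall>\<^sub>F z in nhds y. norm (g z - g y) \<le> 2 * B * (D + 1) * norm (z - y)"
  proof -
    \<comment> \<open>With this constant the error, after applying \<open>P\<close>, is at most half
      of \<open>norm (g z - g y)\<close> and is absorbed on the left.\<close>
    have "1 / (2 * B) > 0" using B by simp
    from f_small[OF this] h_small[OF zero_less_one] show ?thesis
    proof eventually_elim
      case (elim z)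
      have "norm (h z - h y) \<le> norm (h z - h y - h' (z - y)) + norm (h' (z - y))"
        by (metis diff_add_cancel norm_triangle_ineq)
      also have "\<dots> \<le> (D + 1) * norm (z - y)" using elim(2) D(2)[of "z - y"] by (simp add: algebra_simps)
      finally have hz: "norm (h z - h y) \<le> (D + 1) * norm (z - y)" .
      have "norm (g z - g y) = norm (P (h z - h y) - P (h z - h y - f' (g z - g y)))"
        by (simp add: P.diff Pf)
      also have "\<dots> \<le> norm (P (h z - h y)) + norm (P (h z - h y - f' (g z - g y)))"
        by (rule norm_triangle_ineq4)
      also have "\<dots> \<le> norm (h z - h y) * B + norm (h z - h y - f' (g z - g y)) * B"
        by (intro add_mono B)
      also have "\<dots> \<le> ((D + 1) * norm (z - y)) * B + (1 / (2 * B) * norm (g z - g y)) * B"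
        using hz elim(1) B(1) by (intro add_mono mult_right_mono) auto
      also have "\<dots> = B * (D + 1) * norm (z - y) + norm (g z - g y) / 2"
        using B(1) by simp
      finally show ?case by simp
    qed
  qed
  have "\<forall>\<^sub>F z in nhds y. norm (g z - g y - (P \<circ> h') (z - y)) \<le> e * norm (z - y)" if e: "e > 0" for e
  proof -
    define C where "C = 2 * B * (D + 1)"
    have C: "C > 0" using B D by (simp add: C_def)
    \<comment> \<open>After applying \<open>P\<close>, and \<open>lip\<close> in the first case,
      each of the two errors contributes at most \<open>e / 2 * norm (z - y)\<close>.\<close>
    have "e / (2 * B * C) > 0" "e / (2 * B) > 0" using B C e by auto
    from f_small[OF this(1)] h_small[OF this(2)] lip show ?thesis
    proof eventually_elim
      case (elim z)
      have "norm (g z - g y - (P \<circ> h') (z - y)) = norm (P (h z - h y - h' (z - y)) - P (h z - h y - f' (g z - g y)))"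
        by (simp only: P.diff Pf o_apply) (simp add: algebra_simps)
      also have "\<dots> \<le> norm (P (h z - h y - h' (z - y))) + norm (P (h z - h y - f' (g z - g y)))"
        by (rule norm_triangle_ineq4)
      also have "\<dots> \<le> norm (h z - h y - h' (z - y)) * B + norm (h z - h y - f' (g z - g y)) * B"
        by (intro add_mono B)
      also have "\<dots> \<le> (e / (2 * B) * norm (z - y)) * B + (e / (2 * B * C) * (C * norm (z - y))) * B"
      proof (intro add_mono mult_right_mono)
        show "norm (h z - h y - f' (g z - g y)) \<le> e / (2 * B * C) * (C * norm (z - y))"
          using elim(1) elim(3)[folded C_def] B C e
          by (meson \<open>e / (2 * B * C) > 0\<close> less_imp_le mult_left_mono order_trans)
      qed (use elim(2) B in auto)
      also have "\<dots> = e * norm (z - y)" using B C by (simp add: field_simps)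
      finally show ?case .
    qed
  qed
  then show ?thesis
    unfolding has_derivative_at_alt
    using bounded_linear_compose[OF P(1) h.bounded_linear_axioms]
    by (auto simp: o_def eventually_nhds_metric dist_norm)
qed

section \<open>Smooth functions of two variables\<close>

text \<open>On an open set derivatives depend only on the values in that set, at each stage of the
  induction. This serves \<open>smooth_on_pderiv2\<close>, where \<open>pderiv2 i F\<close> is known
  to be a value of the Frechet derivative only on \<open>U\<close>.\<close>

lemma Ck_on_cong:
  assumes "open U" "\<And>x. x \<in> U \<Longrightarrow> F x = G x" "Ck_on m U F"
  shows "Ck_on m U G"
  using assms(2,3)
proof (induction m arbitrary: F G)
  case 0
  then show ?case by (simp cong: continuous_on_cong)
next
  case (Suc m)
  have *: "(G has_derivative frechet_derivative F (at x)) (at x)" if "x \<in> U" for x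
  proof (rule has_derivative_transform_within_open[OF _ assms(1) that, of F])
    have "F differentiable (at x)" using Suc.prems(2) that by simp
    then show "(F has_derivative frechet_derivative F (at x)) (at x)" by (simp only: frechet_derivative_works)
  qed (rule Suc.prems(1))
  have eq: "frechet_derivative F (at x) = frechet_derivative G (at x)" if "x \<in> U" for x
    using frechet_derivative_at[OF *[OF that]] .
  have "Ck_on m U (\<lambda>x. frechet_derivative G (at x) i)" if "i \<in> Basis" for i
    by (rule Suc.IH[of "\<lambda>x. frechet_derivative F (at x) i"]) (use Suc.prems(2) eq that in auto)
  then show ?case using * by (auto simp: differentiable_def)
qed

lemma pderiv2_eq:
  assumes "(F has_derivative F') (at s)"
  shows "pderiv2 i F s = F' (axis i 1)"
proof -
  have "((\<lambda>t. F (s + t *\<^sub>R axis i 1)) has_derivative (\<lambda>t. F' (t *\<^sub>R axis i 1))) (at 0)"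
    by (rule has_derivative_compose[of "\<lambda>t. s + t *\<^sub>R axis i 1" "\<lambda>t. t *\<^sub>R axis i 1" 0 UNIV F F'])
       (use assms in \<open>auto intro!: derivative_eq_intros\<close>)
  moreover have "F' (t *\<^sub>R axis i 1) = t *\<^sub>R F' (axis i 1)" for t
    using linear_cmul[OF has_derivative_linear[OF assms]] .
  ultimately show ?thesis
    unfolding pderiv2_def by (intro vector_derivative_at) (simp add: has_vector_derivative_def)
qed

lemma smooth_on_differentiable: "smooth_on U F \<Longrightarrow> x \<in> U \<Longrightarrow> F differentiable (at x)"
  unfolding smooth_on_def by (metis Ck_on.simps(2))

lemma smooth_on_has_derivative:
  "smooth_on U F \<Longrightarrow> x \<in> U \<Longrightarrow> (F has_derivative frechet_derivative F (at x)) (at x)"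
  using smooth_on_differentiable frechet_derivative_works by blast

lemma smooth_on_pderiv2:
  assumes "open U" "smooth_on U F"
  shows "smooth_on U (pderiv2 i F)"
  unfolding smooth_on_def
proof
  fix m
  have "Ck_on (Suc m) U F" using assms by (simp add: smooth_on_def)
  then have "Ck_on m U (\<lambda>x. frechet_derivative F (at x) (axis i 1))"
    by (auto simp: axis_in_Basis_iff)
  then show "Ck_on m U (pderiv2 i F)"
    by (rule Ck_on_cong[OF assms(1), rotated])
       (simp add: pderiv2_eq[OF smooth_on_has_derivative[OF assms(2)]])
qed

lemma has_derivative_eq_pderiv2:
  assumes "(F has_derivative F') (at s)"
  shows "F' = (\<lambda>w. (w $ 1) *\<^sub>R pderiv2 1 F s + (w $ 2) *\<^sub>R pderiv2 2 F s)"
proof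
  fix w :: "real^2"
  have "w = (w $ 1) *\<^sub>R axis 1 1 + (w $ 2) *\<^sub>R axis 2 1"
    by (simp add: vec_eq_iff forall_2 axis_def)
  then have "F' w = F' ((w $ 1) *\<^sub>R axis 1 1 + (w $ 2) *\<^sub>R axis 2 1)" by simp
  also have "\<dots> = (w $ 1) *\<^sub>R pderiv2 1 F s + (w $ 2) *\<^sub>R pderiv2 2 F s"
    using has_derivative_linear[OF assms]
    by (simp add: linear_add linear_cmul pderiv2_eq[OF assms])
  finally show "F' w = (w $ 1) *\<^sub>R pderiv2 1 F s + (w $ 2) *\<^sub>R pderiv2 2 F s" .
qed

text \<open>The mean value theorem requires real values, so the symmetry is applied to each
  component \<open>F x \<bullet> b\<close>.\<close>

lemma mixed_pderiv2:
  fixes F :: "real^2 \<Rightarrow> 'b::euclidean_space"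
  assumes U: "open U" "s \<in> U" and F: "smooth_on U F"
  shows "pderiv2 i (pderiv2 j F) s = pderiv2 j (pderiv2 i F) s"
proof (rule euclidean_eqI)
  fix b :: 'b assume "b \<in> Basis"
  let ?F' = "\<lambda>x w. frechet_derivative F (at x) w"
  have *: "((\<lambda>x. ?F' x (axis k 1) \<bullet> b) has_derivative (\<lambda>w. frechet_derivative (pderiv2 k F) (at s) w \<bullet> b)) (at s)" for k
  proof (rule has_derivative_transform_within_open[OF _ U])
    show "((\<lambda>x. pderiv2 k F x \<bullet> b) has_derivative (\<lambda>w. frechet_derivative (pderiv2 k F) (at s) w \<bullet> b)) (at s)"
      by (intro has_derivative_inner_left smooth_on_has_derivative[OF smooth_on_pderiv2[OF U(1) F] U(2)])
  qed (simp add: pderiv2_eq[OF smooth_on_has_derivative[OF F]])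
  have d: "((\<lambda>x. F x \<bullet> b) has_derivative (\<lambda>w. ?F' x w \<bullet> b)) (at x)" if "x \<in> U" for x
    by (intro has_derivative_inner_left smooth_on_has_derivative[OF F that])
  show "pderiv2 i (pderiv2 j F) s \<bullet> b = pderiv2 j (pderiv2 i F) s \<bullet> b"
    using second_derivative_symmetric_real[OF U d * *, of j i]
    by (simp add: pderiv2_eq[OF smooth_on_has_derivative[OF smooth_on_pderiv2[OF U(1) F] U(2)]])
qed

section \<open>Cross products and independence of the normal from the chart\<close>

text \<open>With coefficients from the chain rule, the factor is the Jacobian determinant of a
  change of charts.\<close>

lemma cross3_linear_combination:
  "cross3 (a *\<^sub>R u + b *\<^sub>R v) (c *\<^sub>R u + d *\<^sub>R v) = (a * d - b * c) *\<^sub>R cross3 u v"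
  by (simp add: cross3_simps)

lemma bounded_bilinear_cross3: "bounded_bilinear cross3"
  using bilinear_cross by (simp add: bilinear_conv_bounded_bilinear)

text \<open>Taking the cross product of \<open>T w = 0\<close> with either basis image isolates one
  coordinate of \<open>w\<close>.\<close>

lemma inj_linear_map2:
  fixes T :: "real^2 \<Rightarrow> real^3"
  assumes "linear T" "cross3 (T (axis 1 1)) (T (axis 2 1)) \<noteq> 0"
  shows "inj T"
  unfolding linear_injective_0[OF assms(1)]
proof (intro allI impI)
  fix w assume "T w = 0"
  have "w = (w $ 1) *\<^sub>R axis 1 1 + (w $ 2) *\<^sub>R axis 2 1"
    by (simp add: vec_eq_iff forall_2 axis_def)
  then have "T w = T ((w $ 1) *\<^sub>R axis 1 1 + (w $ 2) *\<^sub>R axis 2 1)" by (rule arg_cong)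
  also have "\<dots> = (w $ 1) *\<^sub>R T (axis 1 1) + (w $ 2) *\<^sub>R T (axis 2 1)"
    using assms(1) by (simp add: linear_add linear_cmul)
  finally have 0: "0 = (w $ 1) *\<^sub>R T (axis 1 1) + (w $ 2) *\<^sub>R T (axis 2 1)" (is "_ = ?v")
    using \<open>T w = 0\<close> by simp
  have "cross3 ?v (T (axis 2 1)) = (w $ 1) *\<^sub>R cross3 (T (axis 1 1)) (T (axis 2 1))"
    "cross3 (T (axis 1 1)) ?v = (w $ 2) *\<^sub>R cross3 (T (axis 1 1)) (T (axis 2 1))"
    by (simp_all add: cross_add_left cross_add_right cross_mult_left cross_mult_right)
  then have "w $ 1 = 0" "w $ 2 = 0"
    using assms(2) unfolding 0[symmetric] by auto
  then show "w = 0" by (simp add: vec_eq_iff forall_2)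
qed

lemma cross3_nonzero_of_inj:
  fixes T :: "real^2 \<Rightarrow> real^3"
  assumes "linear T" "inj T"
  shows "cross3 (T (axis 1 1)) (T (axis 2 1)) \<noteq> 0"
proof
  let ?u = "T (axis 1 1)" and ?v = "T (axis 2 1)"
  assume 0: "cross3 ?u ?v = 0"
  \<comment> \<open>Lagrange's formula shows that the image of this vector is a double cross product
    containing \<open>cross3 ?u ?v\<close>, hence 0. By injectivity its first coordinate
    \<open>?v \<bullet> ?v\<close> vanishes.\<close>
  have "T ((?v \<bullet> ?v) *\<^sub>R axis 1 1 - (?u \<bullet> ?v) *\<^sub>R axis 2 1) = (?v \<bullet> ?v) *\<^sub>R ?u - (?u \<bullet> ?v) *\<^sub>R ?v"
    using assms(1) by (simp add: linear_diff linear_cmul)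
  also have "\<dots> = cross3 ?v (cross3 ?u ?v)"
    by (simp add: Lagrange inner_commute)
  finally have "(?v \<bullet> ?v) *\<^sub>R axis 1 1 - (?u \<bullet> ?v) *\<^sub>R axis 2 1 = (0::real^2)"
    using assms(2) unfolding linear_injective_0[OF assms(1)] 0 cross_zero_right by blast
  then have "?v = 0"
    by (simp add: vec_eq_iff forall_2 axis_def)
  then have "axis 2 1 = (0::real^2)"
    using assms(2) unfolding linear_injective_0[OF assms(1)] by blast
  then show False by (simp add: axis_eq_0_iff)
qed

text \<open>For every \<open>g\<close> differentiable in the second chart, the cross products of the
  partial derivatives of \<open>g \<circ> x1\<close> and \<open>g \<circ> x2\<close> differ by the
  Jacobian determinant \<delta> of the transition map \<phi>. For \<open>g = id\<close>, the
  orientation of both charts gives \<delta> > 0; for \<open>g = f\<close>, this positive factor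
  disappears on normalizing.\<close>

lemma normal_chart_independent:
  assumes 1: "oriented_coords U1 x1" "s1 \<in> U1" and 2: "oriented_coords U2 x2" "s2 \<in> U2"
    and eq: "x1 s1 = x2 s2" and f: "(f \<circ> x2) differentiable (at s2)"
  shows "normal (f \<circ> x1) s1 = normal (f \<circ> x2) s2"
proof -
  obtain y2 where y2: "homeomorphism U2 (x2 ` U2) x2 y2"
    using 2(1) by (auto simp: oriented_coords_def)
  define \<phi> where "\<phi> = y2 \<circ> x1"
  have \<phi>s: "\<phi> s1 = s2" using y2 2(2) eq by (simp add: \<phi>_def homeomorphism_apply1)
  have U1: "open U1" "smooth_on U1 x1" "x1 ` U1 \<subseteq> S2"
    and pos1: "cross3 (pderiv2 1 x1 s1) (pderiv2 2 x1 s1) \<bullet> x1 s1 > 0"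
    using 1 by (auto simp: oriented_coords_def)
  have U2: "smooth_on U2 x2" "openin (top_of_set S2) (x2 ` U2)"
    and pos2: "cross3 (pderiv2 1 x2 s2) (pderiv2 2 x2 s2) \<bullet> x2 s2 > 0"
    using 2 by (auto simp: oriented_coords_def)
  obtain x1' x2' f' where x1': "(x1 has_derivative x1') (at s1)" and x2': "(x2 has_derivative x2') (at s2)"
    and f': "((f \<circ> x2) has_derivative f') (at s2)"
    using smooth_on_differentiable[OF U1(2) 1(2)] smooth_on_differentiable[OF U2(1) 2(2)] f
    unfolding differentiable_def by blast
  have cont: "isCont x1 s1" using x1' by (rule has_derivative_continuous)
  \<comment> \<open>The image of \<open>x2\<close> is relatively open in the sphere, so
    \<open>x1\<close> stays in it near \<open>s1\<close> and \<phi> is a change of charts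
    there.\<close>
  obtain T where T: "open T" "x2 ` U2 = S2 \<inter> T" using U2(2) by (auto simp: openin_open)
  have "x1 s1 \<in> T" using T eq 2(2) by auto
  then have "\<forall>\<^sub>F r in nhds s1. x1 r \<in> T"
    using cont T(1) by (simp add: isCont_def tendsto_at_iff_tendsto_nhds topological_tendstoD)
  moreover have "\<forall>\<^sub>F r in nhds s1. r \<in> U1" using U1(1) 1(2) by (rule eventually_nhds_in_open)
  ultimately have in2: "\<forall>\<^sub>F r in nhds s1. x1 r \<in> x2 ` U2"
    by eventually_elim (use T U1(3) in auto)
  then have inv: "\<forall>\<^sub>F r in nhds s1. x2 (\<phi> r) = x1 r"
    by eventually_elim (use y2 in \<open>auto simp: \<phi>_def homeomorphism_apply1\<close>)
  have \<phi>cont: "isCont \<phi> s1"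
  proof -
    have "continuous (at (x1 s1) within x2 ` U2) y2"
      using y2 2(2) eq by (simp add: homeomorphism_def continuous_on_eq_continuous_within)
    moreover have "\<forall>\<^sub>F r in at s1. x1 r \<in> x2 ` U2"
      using in2 by (auto simp: eventually_at_filter elim: eventually_mono)
    moreover have "(x1 \<longlongrightarrow> x1 s1) (at s1)" using cont by (simp add: isCont_def)
    ultimately have "((\<lambda>r. y2 (x1 r)) \<longlongrightarrow> y2 (x1 s1)) (at s1)"
      by (rule continuous_within_tendsto_compose)
    then show ?thesis by (simp add: \<phi>_def isCont_def o_def)
  qed
  have "cross3 (x2' (axis 1 1)) (x2' (axis 2 1)) \<noteq> 0"
    using pos2 by (auto simp: pderiv2_eq[OF x2'])
  then obtain P where P: "linear P" "P \<circ> x2' = id"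
    using inj_linear_map2[OF has_derivative_linear[OF x2']] linear_injective_left_inverse[OF has_derivative_linear[OF x2']] by blast
  define \<phi>' where "\<phi>' = P \<circ> x1'"
  have \<phi>': "(\<phi> has_derivative \<phi>') (at s1)"
    unfolding \<phi>'_def
    by (rule has_derivative_factor[OF _ _ P(2) \<phi>cont x1' inv]) (use x2' \<phi>s P(1) in \<open>auto simp: linear_conv_bounded_linear\<close>)
  have chain: "pderiv2 i (g \<circ> x1) s1 = (\<phi>' (axis i 1) $ 1) *\<^sub>R pderiv2 1 (g \<circ> x2) s2 + (\<phi>' (axis i 1) $ 2) *\<^sub>R pderiv2 2 (g \<circ> x2) s2"
    if "((g \<circ> x2) has_derivative g') (at s2)" for g :: "real^3 \<Rightarrow> real^3" and g' i
  proof -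
    have "((\<lambda>r. (g \<circ> x2) (\<phi> r)) has_derivative (\<lambda>w. g' (\<phi>' w))) (at s1)"
      by (rule has_derivative_compose[OF \<phi>']) (simp only: \<phi>s that)
    then have "((g \<circ> x1) has_derivative (\<lambda>w. g' (\<phi>' w))) (at s1)"
    proof (rule has_derivative_transform_eventually)
      show "\<forall>\<^sub>F r in at s1. (g \<circ> x2) (\<phi> r) = (g \<circ> x1) r"
        using inv by (auto simp: eventually_at_filter elim: eventually_mono)
    qed (simp_all add: \<phi>s eq)
    then show ?thesis
      by (simp add: pderiv2_eq has_derivative_eq_pderiv2[OF that])
  qed
  define \<delta> where "\<delta> = \<phi>' (axis 1 1) $ 1 * \<phi>' (axis 2 1) $ 2 - \<phi>' (axis 1 1) $ 2 * \<phi>' (axis 2 1) $ 1"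
  have cross: "cross3 (pderiv2 1 (g \<circ> x1) s1) (pderiv2 2 (g \<circ> x1) s1) =
      \<delta> *\<^sub>R cross3 (pderiv2 1 (g \<circ> x2) s2) (pderiv2 2 (g \<circ> x2) s2)"
    if "((g \<circ> x2) has_derivative g') (at s2)" for g :: "real^3 \<Rightarrow> real^3" and g'
    by (simp only: chain[OF that] cross3_linear_combination \<delta>_def)
  have "\<delta> > 0"
    using cross[of id x2'] x2' pos1 pos2 eq by (simp add: zero_less_mult_iff)
  then show ?thesis
    by (simp add: normal_def cross[OF f'])
qed

section \<open>Unit normal and second fundamental form\<close>

text \<open>This models an embedding read in a single chart; the pointwise computations take place
  here.\<close>

locale regular_surface =
  fixes U :: "(real^2) set" and F :: "real^2 \<Rightarrow> real^3"
  assumes open_U: "open U" and smooth: "smooth_on U F"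
    and immersion: "s \<in> U \<Longrightarrow> cross3 (pderiv2 1 F s) (pderiv2 2 F s) \<noteq> 0"
begin

lemma norm_normal: "s \<in> U \<Longrightarrow> norm (normal F s) = 1"
  by (simp add: normal_def immersion)

lemma inner_normal_normal: "s \<in> U \<Longrightarrow> normal F s \<bullet> normal F s = 1"
  using norm_normal by (simp add: norm_eq_1)

text \<open>A cross product is orthogonal to its factors. This holds at every \<open>s\<close>,
  since \<open>normal F s\<close> is 0 where the cross product vanishes, so it is available as an
  identity of functions in \<open>second_form_eq\<close>.\<close>

lemma inner_pderiv2_normal: "pderiv2 i F s \<bullet> normal F s = 0"
  using exhaust_2[of i] by (auto simp: normal_def dot_cross_self)

lemma differentiable_pderiv2: "s \<in> U \<Longrightarrow> pderiv2 i F differentiable (at s)"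
  by (rule smooth_on_differentiable[OF smooth_on_pderiv2[OF open_U smooth]])

lemma differentiable_normal:
  assumes "s \<in> U"
  shows "normal F differentiable (at s)"
proof -
  have "(\<lambda>r. cross3 (pderiv2 1 F r) (pderiv2 2 F r)) differentiable (at s)" (is "?W differentiable _")
  proof -
    obtain F1' F2' where "(pderiv2 1 F has_derivative F1') (at s)" "(pderiv2 2 F has_derivative F2') (at s)"
      using differentiable_pderiv2[OF assms] unfolding differentiable_def by blast
    from bounded_bilinear.FDERIV[OF bounded_bilinear_cross3 this] show ?thesis
      unfolding differentiable_def by blast
  qed
  moreover from this have "(\<lambda>r. inverse (norm (?W r))) differentiable (at s)"
    using immersion[OF assms]
    by (intro differentiable_compose[of inverse "\<lambda>r. norm (?W r)"] differentiable_inverse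
        differentiable_compose[of norm ?W] differentiable_norm_at) auto
  ultimately show ?thesis
    unfolding normal_def[abs_def] by (intro differentiable_scaleR)
qed

text \<open>Differentiate \<open>normal F r \<bullet> normal F r = 1\<close>.\<close>

lemma inner_normal_pderiv2_normal:
  assumes "s \<in> U"
  shows "normal F s \<bullet> pderiv2 i (normal F) s = 0"
proof -
  obtain N' where N': "(normal F has_derivative N') (at s)"
    using differentiable_normal[OF assms] by (auto simp: differentiable_def)
  have "((\<lambda>r. normal F r \<bullet> normal F r) has_derivative (\<lambda>w. normal F s \<bullet> N' w + N' w \<bullet> normal F s)) (at s)"
    by (rule has_derivative_inner[OF N' N'])
  moreover have "((\<lambda>r. normal F r \<bullet> normal F r) has_derivative (\<lambda>w. 0)) (at s)"
    by (rule has_derivative_transform_within_open[OF has_derivative_const open_U assms, of 1])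
       (simp add: inner_normal_normal)
  ultimately have "(\<lambda>w. normal F s \<bullet> N' w + N' w \<bullet> normal F s) = (\<lambda>w. 0)"
    by (rule has_derivative_unique)
  from fun_cong[OF this, of "axis i 1"] show ?thesis
    by (simp add: pderiv2_eq[OF N'] inner_commute)
qed

text \<open>Differentiating \<open>pderiv2 i F r \<bullet> normal F r = 0\<close> moves the
  derivative from the normal to \<open>pderiv2 i F\<close>; in this form the symmetry of second
  derivatives applies.\<close>

lemma second_form_eq:
  assumes "s \<in> U"
  shows "second_form F s $ i $ j = pderiv2 j (pderiv2 i F) s \<bullet> normal F s"
proof -
  obtain N' G' where N': "(normal F has_derivative N') (at s)" and G': "(pderiv2 i F has_derivative G') (at s)"
    using differentiable_normal[OF assms] differentiable_pderiv2[OF assms] unfolding differentiable_def by blast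
  have "((\<lambda>r. pderiv2 i F r \<bullet> normal F r) has_derivative (\<lambda>w. pderiv2 i F s \<bullet> N' w + G' w \<bullet> normal F s)) (at s)"
    by (rule has_derivative_inner[OF G' N'])
  then have "((\<lambda>r. 0) has_derivative (\<lambda>w. pderiv2 i F s \<bullet> N' w + G' w \<bullet> normal F s)) (at s)"
    by (simp add: inner_pderiv2_normal)
  then have "(\<lambda>w. pderiv2 i F s \<bullet> N' w + G' w \<bullet> normal F s) = (\<lambda>w. 0)"
    by (rule has_derivative_unique) (rule has_derivative_const)
  from fun_cong[OF this, of "axis j 1"] show ?thesis
    by (simp add: pderiv2_eq[OF N'] pderiv2_eq[OF G'] second_form_def)
qed

lemma second_form_symmetric:
  "s \<in> U \<Longrightarrow> second_form F s $ i $ j = second_form F s $ j $ i"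
  using mixed_pderiv2[OF open_U _ smooth] by (simp add: second_form_eq)

end

section \<open>First variations of metric and normal\<close>

lemma first_form_entry: "first_form F s $ i $ j = pderiv2 i F s \<bullet> pderiv2 j F s"
  by (simp add: first_form_def matrix_matrix_mult_def transpose_def Jac_def inner_vec_def)

lemma pderiv2_add_scaleR:
  assumes "F differentiable (at s)" "D differentiable (at s)"
  shows "pderiv2 i (\<lambda>r. F r + t *\<^sub>R D r) s = pderiv2 i F s + t *\<^sub>R pderiv2 i D s"
proof -
  obtain F' D' where FD: "(F has_derivative F') (at s)" "(D has_derivative D') (at s)"
    using assms unfolding differentiable_def by blast
  have "((\<lambda>r. F r + t *\<^sub>R D r) has_derivative (\<lambda>w. F' w + t *\<^sub>R D' w)) (at s)"
    by (intro has_derivative_add has_derivative_scaleR_right FD)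
  from pderiv2_eq[OF this] show ?thesis by (simp add: FD[THEN pderiv2_eq])
qed

text \<open>Along \<open>F + t D\<close> the first form is a quadratic polynomial in
  \<open>t\<close>; its variation is the linear coefficient \<open>B\<close>.\<close>

lemma var_first_form_entry:
  assumes "F differentiable (at s)" "D differentiable (at s)"
  shows "var_first_form F D s $ i $ j = pderiv2 i F s \<bullet> pderiv2 j D s + pderiv2 i D s \<bullet> pderiv2 j F s"
proof -
  define B where "B = (\<chi> i j. pderiv2 i F s \<bullet> pderiv2 j D s + pderiv2 i D s \<bullet> pderiv2 j F s)"
  define E where "E = (\<chi> i j. pderiv2 i D s \<bullet> pderiv2 j D s)"
  have "first_form (\<lambda>r. F r + t *\<^sub>R D r) s = first_form F s + t *\<^sub>R B + (t * t) *\<^sub>R E" for t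
    by (simp add: vec_eq_iff first_form_entry pderiv2_add_scaleR[OF assms] B_def E_def inner_simps algebra_simps)
  moreover have "((\<lambda>t. first_form F s + t *\<^sub>R B + (t * t) *\<^sub>R E) has_vector_derivative B) (at 0)"
    by (auto intro!: derivative_eq_intros simp: has_vector_derivative_def)
  ultimately have "var_first_form F D s = B"
    unfolding var_first_form_def by (simp add: vector_derivative_at)
  then show ?thesis by (simp add: B_def)
qed

text \<open>The norm of \<open>W\<close> has derivative \<open>n \<bullet> W'\<close>, so
  normalizing removes the component of \<open>W'\<close> along \<open>n\<close>.\<close>

lemma has_vector_derivative_normalize:
  fixes W :: "real \<Rightarrow> 'a::real_inner"
  assumes W: "(W has_vector_derivative W') (at t)" and nz: "W t \<noteq> 0"
  defines "n \<equiv> W t /\<^sub>R norm (W t)"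
  shows "((\<lambda>t. W t /\<^sub>R norm (W t)) has_vector_derivative ((W' - (n \<bullet> W') *\<^sub>R n) /\<^sub>R norm (W t))) (at t)"
proof -
  have "((\<lambda>t. norm (W t)) has_derivative (\<lambda>h. (h *\<^sub>R W') \<bullet> sgn (W t))) (at t)"
    using has_derivative_compose[OF W[unfolded has_vector_derivative_def] has_derivative_norm[OF nz]] .
  moreover have "(\<lambda>h. (h *\<^sub>R W') \<bullet> sgn (W t)) = (*) (n \<bullet> W')"
    by (simp add: fun_eq_iff n_def sgn_div_norm inner_commute)
  ultimately have "((\<lambda>t. norm (W t)) has_real_derivative (n \<bullet> W')) (at t)"
    by (simp add: has_field_derivative_def)
  then have "((\<lambda>t. inverse (norm (W t))) has_real_derivative - (inverse (norm (W t)) * (n \<bullet> W') * inverse (norm (W t)))) (at t)"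
    by (rule DERIV_inverse') (use nz in simp)
  from has_vector_derivative_scaleR[OF this W] show ?thesis
    by (simp add: n_def algebra_simps)
qed

text \<open>By the product rule \<open>W'\<close> is the derivative at 0 of the unnormalized normal
  of \<open>F + t D\<close>.\<close>

lemma var_normal_eq:
  assumes "F differentiable (at s)" "D differentiable (at s)"
    and nz: "cross3 (pderiv2 1 F s) (pderiv2 2 F s) \<noteq> 0"
  defines "W' \<equiv> cross3 (pderiv2 1 F s) (pderiv2 2 D s) + cross3 (pderiv2 1 D s) (pderiv2 2 F s)"
  shows "var_normal F D s =
    (W' - (normal F s \<bullet> W') *\<^sub>R normal F s) /\<^sub>R norm (cross3 (pderiv2 1 F s) (pderiv2 2 F s))"
proof -
  define W where "W t = cross3 (pderiv2 1 F s + t *\<^sub>R pderiv2 1 D s) (pderiv2 2 F s + t *\<^sub>R pderiv2 2 D s)" for t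
  have lin: "((\<lambda>t. pderiv2 i F s + t *\<^sub>R pderiv2 i D s) has_vector_derivative pderiv2 i D s) (at 0)" for i
    by (auto intro!: derivative_eq_intros simp: has_vector_derivative_def)
  have "(W has_vector_derivative W') (at 0)"
    using bounded_bilinear.has_vector_derivative[OF bounded_bilinear_cross3 lin lin, of 1 2]
    by (simp add: W_def[abs_def] W'_def)
  from has_vector_derivative_normalize[OF this] nz
  have "((\<lambda>t. W t /\<^sub>R norm (W t)) has_vector_derivative
      ((W' - (normal F s \<bullet> W') *\<^sub>R normal F s) /\<^sub>R norm (cross3 (pderiv2 1 F s) (pderiv2 2 F s)))) (at 0)"
    by (simp add: W_def normal_def)
  moreover have "normal (\<lambda>r. F r + t *\<^sub>R D r) s = W t /\<^sub>R norm (W t)" for t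
    by (simp add: normal_def W_def pderiv2_add_scaleR[OF assms(1,2)])
  ultimately show ?thesis
    unfolding var_normal_def by (simp add: vector_derivative_at)
qed

section \<open>Variations in the normal direction\<close>

text \<open>Product rule; as \<open>U\<close> is open, the values of \<open>D\<close> on
  \<open>U\<close> fix its derivative at \<open>s\<close>.\<close>

lemma (in regular_surface) normal_variation:
  assumes s: "s \<in> U" and H: "H differentiable (at s)" and D: "\<forall>r\<in>U. D r = H r *\<^sub>R normal F r"
  shows "D differentiable (at s)"
    and "pderiv2 i D s = pderiv2 i H s *\<^sub>R normal F s + H s *\<^sub>R pderiv2 i (normal F) s"
proof -
  obtain H' N' where H': "(H has_derivative H') (at s)" and N': "(normal F has_derivative N') (at s)"
    using H differentiable_normal[OF s] unfolding differentiable_def by blast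
  have "((\<lambda>r. H r *\<^sub>R normal F r) has_derivative (\<lambda>w. H s *\<^sub>R N' w + H' w *\<^sub>R normal F s)) (at s)"
    by (rule has_derivative_scaleR[OF H' N'])
  then have D': "(D has_derivative (\<lambda>w. H s *\<^sub>R N' w + H' w *\<^sub>R normal F s)) (at s)"
    by (rule has_derivative_transform_within_open[OF _ open_U s]) (use D in simp)
  then show "D differentiable (at s)" by (auto simp: differentiable_def)
  show "pderiv2 i D s = pderiv2 i H s *\<^sub>R normal F s + H s *\<^sub>R pderiv2 i (normal F) s"
    by (simp add: pderiv2_eq[OF D'] pderiv2_eq[OF H'] pderiv2_eq[OF N'])
qed

text \<open>Derivatives of \<open>H\<close> come with a factor
  \<open>normal F s \<bullet> pderiv2 j F s = 0\<close>. Each of the two other terms is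
  \<open>- H s\<close> times the second form, one of them by its symmetry.\<close>

lemma (in regular_surface) var_first_form_normal_variation:
  assumes "s \<in> U" "H differentiable (at s)" "\<forall>r\<in>U. D r = H r *\<^sub>R normal F r"
  shows "var_first_form F D s = (- 2 * H s) *\<^sub>R second_form F s"
proof -
  have "pderiv2 i F s \<bullet> pderiv2 j (normal F) s = - second_form F s $ i $ j" for i j
    by (simp add: second_form_def)
  moreover have "pderiv2 i (normal F) s \<bullet> pderiv2 j F s = - second_form F s $ i $ j" for i j
    using second_form_symmetric[OF assms(1), of i j] by (simp add: second_form_def inner_commute)
  moreover have "normal F s \<bullet> pderiv2 j F s = 0" for j
    using inner_pderiv2_normal[of j s] by (simp add: inner_commute)
  ultimately show ?thesis
    by (simp add: vec_eq_iff var_first_form_entry[OF smooth_on_differentiable[OF smooth assms(1)] normal_variation(1)[OF assms]]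
        normal_variation(2)[OF assms] inner_simps inner_pderiv2_normal)
qed

text \<open>As a double cross product, the tangential projection in \<open>var_normal_eq\<close> can
  be evaluated by \<open>Lagrange\<close> alone.\<close>

lemma sub_projection_unit:
  fixes n v :: "real^3"
  assumes "n \<bullet> n = 1"
  shows "v - (n \<bullet> v) *\<^sub>R n = - cross3 n (cross3 n v)"
  by (simp add: Lagrange assms)

text \<open>Let \<open>n\<close> be the unit normal. By Lagrange's formula
  \<open>cross3 n (cross3 v w)\<close> vanishes for tangent \<open>v\<close>, \<open>w\<close>,
  which removes the terms with derivatives of \<open>n\<close>; and
  \<open>- cross3 n (cross3 n v) = v\<close> for tangent \<open>v\<close> preserves those with
  derivatives of \<open>H\<close>.\<close>

lemma (in regular_surface) var_normal_normal_variation: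
  assumes "s \<in> U" "H differentiable (at s)" "\<forall>r\<in>U. D r = H r *\<^sub>R normal F r"
  shows "var_normal F D s =
    (pderiv2 2 H s *\<^sub>R cross3 (pderiv2 1 F s) (normal F s) + pderiv2 1 H s *\<^sub>R cross3 (normal F s) (pderiv2 2 F s))
      /\<^sub>R norm (cross3 (pderiv2 1 F s) (pderiv2 2 F s))"
proof -
  let ?n = "normal F s"
  have n: "?n \<bullet> ?n = 1" "?n \<bullet> pderiv2 i F s = 0" "?n \<bullet> pderiv2 i (normal F) s = 0" for i
    using assms(1) inner_pderiv2_normal[of i s]
    by (simp_all add: inner_normal_normal inner_normal_pderiv2_normal inner_commute)
  show ?thesis
    unfolding var_normal_eq[OF smooth_on_differentiable[OF smooth assms(1)] normal_variation(1)[OF assms] immersion[OF assms(1)]]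
      sub_projection_unit[OF n(1)] normal_variation(2)[OF assms]
    by (simp add: cross_add_left cross_add_right cross_mult_left cross_mult_right Lagrange n
        Cross3.right_diff_distrib cross_skew[of "pderiv2 1 F s" ?n] algebra_simps)
qed

section \<open>The gradient term\<close>

text \<open>\<open>matrix_inv\<close> is a choice among two-sided inverses; their uniqueness
  identifies it with the adjugate over the determinant.\<close>

lemma matrix_inv_2:
  fixes A :: "real^2^2"
  assumes "det A \<noteq> 0"
  shows "matrix_inv A = inverse (det A) *\<^sub>R vector [vector [A$2$2, - A$1$2], vector [- A$2$1, A$1$1]]" (is "_ = ?B")
proof -
  have B: "A ** ?B = mat 1" "?B ** A = mat 1"
    using assms
    by (simp_all add: vec_eq_iff forall_2 matrix_matrix_mult_def sum_2 mat_def det_2 divide_simps)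
  then have "A ** matrix_inv A = mat 1 \<and> matrix_inv A ** A = mat 1"
    unfolding matrix_inv_def by (intro someI[of "\<lambda>X. A ** X = mat 1 \<and> X ** A = mat 1"] conjI)
  then have "?B ** (A ** matrix_inv A) = ?B" by (simp only: matrix_mul_rid)
  then show ?thesis by (simp only: matrix_mul_assoc B(2) matrix_mul_lid)
qed

lemma inner_2: "v \<bullet> w = v $ 1 * w $ 1 + v $ 2 * w $ 2" for v w :: "real^2"
  by (simp add: inner_vec_def sum_2)

text \<open>Lagrange's identity for the squared norm of a cross product.\<close>

lemma det_first_form:
  "det (first_form F s) = (norm (cross3 (pderiv2 1 F s) (pderiv2 2 F s)))\<^sup>2"
  unfolding power2_norm_eq_inner dot_cross by (simp add: det_2 first_form_entry)

text \<open>By \<open>dot_cross\<close>, the products of \<open>cross3 n (pderiv2 2 F s)\<close> and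
  \<open>cross3 (pderiv2 1 F s) n\<close> are the entries of the adjugate of the first form; the two
  factors \<open>1 / w\<close> supply the inverse of its determinant.\<close>

lemma (in regular_surface) inner_var_normal:
  assumes "s \<in> U" "H differentiable (at s)" "\<forall>r\<in>U. D r = H r *\<^sub>R normal F r"
    "K differentiable (at s)" "\<forall>r\<in>U. E r = K r *\<^sub>R normal F r"
  shows "var_normal F D s \<bullet> var_normal F E s = grad2 H s \<bullet> (matrix_inv (first_form F s) *v grad2 K s)"
proof -
  let ?n = "normal F s"
  have n: "?n \<bullet> ?n = 1" "?n \<bullet> pderiv2 i F s = 0" "pderiv2 i F s \<bullet> ?n = 0" for i
    using assms(1) inner_pderiv2_normal[of i s]
    by (simp_all add: inner_normal_normal inner_commute)
  define w where "w = norm (cross3 (pderiv2 1 F s) (pderiv2 2 F s))"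
  have w: "w \<noteq> 0" "det (first_form F s) = w\<^sup>2"
    using immersion[OF assms(1)] by (auto simp: w_def det_first_form)
  then have "det (first_form F s) \<noteq> 0" by simp
  then show ?thesis
    unfolding var_normal_normal_variation[OF assms(1-3)] var_normal_normal_variation[OF assms(1,4,5)]
      w_def[symmetric]
    by (simp add: matrix_inv_2 w inner_add_left inner_add_right dot_cross n matrix_vector_mult_def inner_2 sum_2
       grad2_def first_form_entry)
       (simp add: w field_simps power2_eq_square inner_commute)
qed

section \<open>Eigenvalues and the integrand\<close>

text \<open>Evaluating the characteristic polynomial at 0 gives the determinant; its value at 1 then
  gives the trace.\<close>

lemma eigenvalues2_trace_det:
  assumes "eigenvalues2 A l1 l2"
  shows "trace A = l1 + l2" "det A = l1 * l2"
proof -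
  have *: "(t - A$1$1) * (t - A$2$2) - A$1$2 * A$2$1 = (t - l1) * (t - l2)" for t
    using assms by (simp add: eigenvalues2_def det_2 mat_def)
  show "det A = l1 * l2" using *[of 0] by (simp add: det_2)
  with *[of 1] show "trace A = l1 + l2" by (simp add: trace_def sum_2 det_2 algebra_simps)
qed

text \<open>The square of the traceless part has as trace half the discriminant of the
  characteristic polynomial.\<close>

lemma trace_traceless_square:
  assumes "eigenvalues2 A l1 l2"
  shows "trace (traceless (p *\<^sub>R A) ** traceless (q *\<^sub>R A)) = p * q * ((l1 - l2)\<^sup>2 / 2)"
proof -
  have "trace (traceless (p *\<^sub>R A) ** traceless (q *\<^sub>R A)) = p * q * (((trace A)\<^sup>2 - 4 * det A) / 2)"
    by (simp add: trace_def sum_2 det_2 traceless_def matrix_matrix_mult_def mat_def field_simps power2_eq_square)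
  also have "(trace A)\<^sup>2 - 4 * det A = (l1 - l2)\<^sup>2"
    by (simp add: eigenvalues2_trace_det[OF assms] power2_eq_square algebra_simps)
  finally show ?thesis .
qed

text \<open>The factors \<open>- 2 * H s\<close> and \<open>- 2 * K s\<close> multiply to
  \<open>4 * H s * K s\<close>; the half in \<open>trace_traceless_square\<close> turns the 4 into
  \<open>2 * a\<close>, while the product of traces keeps \<open>4 * b\<close>.\<close>

lemma (in regular_surface) elastic_integrand_normal_variations:
  assumes s: "s \<in> U" and H: "H differentiable (at s)" "\<forall>r\<in>U. D r = H r *\<^sub>R normal F r"
    and K: "K differentiable (at s)" "\<forall>r\<in>U. E r = K r *\<^sub>R normal F r"
    and l: "eigenvalues2 (shape_operator F s) l1 l2"
  shows "elastic_integrand a b c F D E s =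
    H s * K s * (2 * a * (l1 - l2)\<^sup>2 + 4 * b * (l1 + l2)\<^sup>2)
      + c * (grad2 H s \<bullet> (matrix_inv (first_form F s) *v grad2 K s))"
proof -
  let ?L = "shape_operator F s"
  have G: "matrix_inv (first_form F s) ** var_first_form F D s = (- 2 * H s) *\<^sub>R ?L"
    "matrix_inv (first_form F s) ** var_first_form F E s = (- 2 * K s) *\<^sub>R ?L"
    unfolding var_first_form_normal_variation[OF s H] var_first_form_normal_variation[OF s K] shape_operator_def
    by (simp_all only: matrix_scalar_ac scalar_matrix_assoc)
  have tr: "trace (p *\<^sub>R ?L) = p * (l1 + l2)" for p
    using eigenvalues2_trace_det(1)[OF l] by (simp add: trace_def sum_2 flip: distrib_left)
  show ?thesis
    unfolding elastic_integrand_def Let_def G trace_traceless_square[OF l] tr inner_var_normal[OF s H K]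
    by (simp add: field_simps power2_eq_square)
qed

section \<open>From charts to the sphere\<close>

lemma regular_surface_embedding:
  assumes "oriented_coords U x" "smooth_embedding f"
  shows "regular_surface U (f \<circ> x)"
proof
  show "open U" using assms(1) by (simp add: oriented_coords_def)
  show *: "smooth_on U (f \<circ> x)"
    using assms by (auto simp: smooth_embedding_def smooth_on_S2_def)
  fix s assume "s \<in> U"
  note d = smooth_on_has_derivative[OF * this]
  have "inj (frechet_derivative (f \<circ> x) (at s))"
    using assms \<open>s \<in> U\<close> by (auto simp: smooth_embedding_def)
  then show "cross3 (pderiv2 1 (f \<circ> x) s) (pderiv2 2 (f \<circ> x) s) \<noteq> 0"
    using cross3_nonzero_of_inj[OF has_derivative_linear[OF d]] by (simp add: pderiv2_eq[OF d])
qed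

lemma coord_of_props:
  assumes "coords_at_points C" "p \<in> S2"
  shows "oriented_coords (fst (C p)) (snd (C p))" "coord_of C p \<in> fst (C p)" "snd (C p) (coord_of C p) = p"
  using assms by (auto simp: coords_at_points_def coord_of_def inv_into_into f_inv_into_f)

text \<open>\<open>unit_normal\<close> takes the chart chosen at \<open>x s\<close> itself. Chart
  independence replaces it by the one chart \<open>x\<close>, in which the normal field can be
  differentiated.\<close>

lemma unit_normal_in_coords:
  assumes C: "coords_at_points C" and f: "smooth_embedding f" and x: "oriented_coords U x" "s \<in> U"
  shows "unit_normal C f (x s) = normal (f \<circ> x) s"
proof -
  have p: "x s \<in> S2" using x by (auto simp: oriented_coords_def)
  note c = coord_of_props[OF C p]
  interpret regular_surface "fst (C (x s))" "f \<circ> snd (C (x s))"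
    using regular_surface_embedding[OF c(1) f] .
  show ?thesis
    unfolding unit_normal_def in_coords_def
    by (rule normal_chart_independent[symmetric, OF x c(1,2)]) (simp_all add: c smooth_on_differentiable[OF smooth])
qed

theorem mainTheorem3:
  fixes f :: "real^3 \<Rightarrow> real^3" and h k \<kappa>1 \<kappa>2 :: "real^3 \<Rightarrow> real"
    and a b c :: real and C :: coord_choice
  assumes "coords_at_points C"
    and "smooth_embedding f"
    and "principal_curvatures C f \<kappa>1 \<kappa>2"
    and "smooth_on_S2 h" and "smooth_on_S2 k"
  shows "elastic_metric C a b c f (\<lambda>p. h p *\<^sub>R unit_normal C f p) (\<lambda>p. k p *\<^sub>R unit_normal C f p) =
    (LINT p:S2|area_measure f.
       h p * k p * (2 * a * (\<kappa>1 p - \<kappa>2 p)^2 + 4 * b * (\<kappa>1 p + \<kappa>2 p)^2)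
       + c * (grad2 (in_coords C p h) (coord_of C p) \<bullet>
              (matrix_inv (first_form (in_coords C p f) (coord_of C p))
                 *v grad2 (in_coords C p k) (coord_of C p))))"
proof -
  have "elastic_integrand a b c (in_coords C p f) (in_coords C p (\<lambda>p. h p *\<^sub>R unit_normal C f p))
      (in_coords C p (\<lambda>p. k p *\<^sub>R unit_normal C f p)) (coord_of C p) =
     h p * k p * (2 * a * (\<kappa>1 p - \<kappa>2 p)^2 + 4 * b * (\<kappa>1 p + \<kappa>2 p)^2)
       + c * (grad2 (in_coords C p h) (coord_of C p) \<bullet>
              (matrix_inv (first_form (in_coords C p f) (coord_of C p))
                 *v grad2 (in_coords C p k) (coord_of C p)))"
    if p: "p \<in> S2" for p
  proof -
    note c = coord_of_props[OF assms(1) p]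
    interpret regular_surface "fst (C p)" "in_coords C p f"
      unfolding in_coords_def using regular_surface_embedding[OF c(1) assms(2)] .
    have diff: "in_coords C p g differentiable (at (coord_of C p))" if "smooth_on_S2 g" for g :: "real^3 \<Rightarrow> real"
      using that c by (auto simp: smooth_on_S2_def in_coords_def intro: smooth_on_differentiable)
    \<comment> \<open>All points near \<open>p\<close> are now read in the chart at
      \<open>p\<close>, as differentiation there requires.\<close>
    have D: "\<forall>r\<in>fst (C p). in_coords C p (\<lambda>p. g p *\<^sub>R unit_normal C f p) r = in_coords C p g r *\<^sub>R normal (in_coords C p f) r"
      for g :: "real^3 \<Rightarrow> real"
      using unit_normal_in_coords[OF assms(1,2) c(1)] by (simp add: in_coords_def)
    have l: "eigenvalues2 (shape_operator (in_coords C p f) (coord_of C p)) (\<kappa>1 p) (\<kappa>2 p)"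
      using assms(3) p by (simp add: principal_curvatures_def)
    have "in_coords C p g (coord_of C p) = g p" for g :: "real^3 \<Rightarrow> real"
      by (simp add: in_coords_def c)
    with elastic_integrand_normal_variations[OF c(2) diff[OF assms(4)] D diff[OF assms(5)] D l]
    show ?thesis by simp
  qed
  then show ?thesis
    unfolding elastic_metric_def set_lebesgue_integral_def
    \<comment> \<open>The indicator of the sphere makes both integrands 0 elsewhere, so they agree
      at every point of space.\<close>
    by (intro Bochner_Integration.integral_cong refl) (auto simp: indicator_def)
qed

end
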